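(* Let $(\Omega,\Sigma,P_{\mathbb{D}})$ be a $\mathbb{D}$-probabilistic space, let $X_{\mathbb{D}}$ be an integrable $\mathbb{D}$-random variable on it, and let $A,B\in\Sigma$ be two mutually exclusive events (i.e. $A\cap B=\emptyset$). Then $$P_{\mathbb{D}}(A\cup B)\,E_{A\cup B}(X_{\mathbb{D}})=P_{\mathbb{D}}(A)\,E_{A}(X_{\mathbb{D}})+P_{\mathbb{D}}(B)\,E_{B}(X_{\mathbb{D}}).$$
   Context: The hyperbolic numbers are the commutative ring $\mathbb{D}=\{a+bk \mid a,b\in\mathbb{R},\ k^2=1,\ k\notin\mathbb{R}\}$. Put $e=\frac{1+k}{2}$, $e^{\dagger}=\frac{1-k}{2}$ (so $e^2=e$, $(e^\dagger)^2=e^\dagger$, $ee^\dagger=0$, $e+e^\dagger=1$); every $z=a+bk$ is uniquely $z=v_1e+v_2e^{\dagger}$ with $v_1=a+b$, $v_2=a-b\in\mathbb{R}$, and all algebraic operations are componentwise in $(v_1,v_2)$. Let $\mathbb{D}^+=\{v_1e+v_2e^\dagger \mid v_1,v_2\ge 0\}$; write $z_1\preceq z_2$ if $z_2-z_1\in\mathbb{D}^+$, and $z_1\prec z_2$ if moreover $z_1\neq z_2$. $\mathfrak{S}_{\mathbb{D}}$ is the set of zero divisors of $\mathbb{D}$, i.e. the nonzero real multiples of $e$ and of $e^\dagger$. The topology on $\mathbb{D}$ is the usual topology of $\mathbb{R}^2$ in the coordinates $(v_1,v_2)$. A $\mathbb{D}$-probabilistic space $(\Omega,\Sigma,P_{\mathbb{D}})$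 is a measurable space $(\Omega,\Sigma)$ with a function $P_{\mathbb{D}}\colon\Sigma\to\mathbb{D}$ such that $P_{\mathbb{D}}(A)\succeq 0$ for all $A\in\Sigma$, $P_{\mathbb{D}}(\Omega)\in\{1,e,e^\dagger\}$, and $P_{\mathbb{D}}$ is countably additive on pairwise disjoint sequences in $\Sigma$. Write $P_{\mathbb{D}}=P_1e+P_2e^\dagger$; $P_1,P_2$ are ordinary real measures on $\Sigma$ (each a probability measure or zero). A $\mathbb{D}$-random variable is a function $X_{\mathbb{D}}\colon\Omega\to\mathbb{D}$ with $X_{\mathbb{D}}^{-1}(U)\in\Sigma$ for every open $U\subset\mathbb{D}$; equivalently $X_{\mathbb{D}}=eX_1+e^\dagger X_2$ with $X_1,X_2$ real measurable functions. It is integrable if $X_1$ is Lebesgue integrable with respect to $P_1$ and $X_2$ with respect to $P_2$; then $\int_B X_{\mathbb{D}}\,dP_{\mathbb{D}}=e\int_B X_1\,dP_1+e^\dagger\int_B X_2\,dP_2$ for $B\in\Sigma$, and $E(X_{\mathbb{D}})=\int_\Omega X_{\mathbb{D}}\,dP_{\mathbb{D}}$. The conditional expectation of $X_{\mathbb{D}}$ given an event $B\in\Sigma$ is $$E_B(X_{\mathbb{D}})=\begin{cases}\dfrac{1}{P_{\mathbb{D}}(B)}\displaystyle\int_B X_{\mathbb{D}}\,dP_{\mathbb{D}} & \text{if } P_{\mathbb{D}}(B)\succ0,\ P_{\mathbb{D}}(B)\notin\mathfrak{S}_{\mathbb{D}},\\[2mm] E(X_{\mathbb{D}}) & \text{if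 } P_{\mathbb{D}}(B)=0,\\[1mm] \dfrac{1}{\lambda_1}\Big(\displaystyle\int_B X_{\mathbb{D}}\,dP_{\mathbb{D}}\Big)e+E(X_{\mathbb{D}})e^\dagger & \text{if } P_{\mathbb{D}}(B)=\lambda_1e,\ \lambda_1>0,\\[2mm] E(X_{\mathbb{D}})e+\dfrac{1}{\lambda_2}\Big(\displaystyle\int_B X_{\mathbb{D}}\,dP_{\mathbb{D}}\Big)e^\dagger & \text{if } P_{\mathbb{D}}(B)=\lambda_2e^\dagger,\ \lambda_2>0.\end{cases}$$ *)

theory Defs
  imports "HOL-Analysis.Analysis"
begin

text \<open>\<open>Hyperbolic a b\<close> is the number \<open>a + b k\<close> with \<open>k\<^sup>2 = 1\<close>.\<close>

codatatype hyperbolic = Hyperbolic (hre: real) (him: real)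

lemma hyperbolic_eqI: "hre x = hre y \<Longrightarrow> him x = him y \<Longrightarrow> x = y"
  by (rule hyperbolic.expand) simp

lemma hyperbolic_eq_iff: "x = y \<longleftrightarrow> hre x = hre y \<and> him x = him y"
  by (auto intro: hyperbolic.expand)

instantiation hyperbolic :: comm_ring_1
begin

primcorec zero_hyperbolic where
  "hre 0 = 0"
| "him 0 = 0"

primcorec one_hyperbolic where
  "hre 1 = 1"
| "him 1 = 0"

primcorec plus_hyperbolic where
  "hre (x + y) = hre x + hre y"
| "him (x + y) = him x + him y"

primcorec uminus_hyperbolic where
  "hre (- x) = - hre x"
| "him (- x) = - him x"

primcorec minus_hyperbolic where
  "hre (x - y) = hre x - hre y"
| "him (x - y) = him x - him y"

primcorec times_hyperbolic where
  "hre (x * y) = hre x * hre y + him x * him y"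
| "him (x * y) = hre x * him y + him x * hre y"

instance
  by standard (simp_all add: hyperbolic_eq_iff algebra_simps)

end

instantiation hyperbolic :: real_algebra_1
begin

primcorec scaleR_hyperbolic where
  "hre (scaleR r x) = r * hre x"
| "him (scaleR r x) = r * him x"

instance
  by standard (simp_all add: hyperbolic_eq_iff algebra_simps)

end

definition hyp_k :: hyperbolic
  where "hyp_k = Hyperbolic 0 1"

definition hyp_e :: hyperbolic
  where "hyp_e = (1 / 2) *\<^sub>R (1 + hyp_k)"

definition hyp_ed :: hyperbolic
  where "hyp_ed = (1 / 2) *\<^sub>R (1 - hyp_k)"

text \<open>The idempotent coordinates: \<open>z = v1 z e + v2 z e\<^sup>\<dagger>\<close>, see \<open>idempotent_decomp\<close> below.\<close>

definition v1 :: "hyperbolic \<Rightarrow> real"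
  where "v1 z = hre z + him z"

definition v2 :: "hyperbolic \<Rightarrow> real"
  where "v2 z = hre z - him z"

lemma hyp_k_squared: "hyp_k * hyp_k = 1"
  by (simp add: hyperbolic_eq_iff hyp_k_def)

lemma idempotents:
  "hyp_e * hyp_e = hyp_e" "hyp_ed * hyp_ed = hyp_ed"
  "hyp_e * hyp_ed = 0" "hyp_e + hyp_ed = 1"
  by (simp_all add: hyperbolic_eq_iff hyp_k_def hyp_e_def hyp_ed_def)

lemma v12_simps [simp]:
  "v1 0 = 0" "v1 1 = 1" "v1 hyp_e = 1" "v1 hyp_ed = 0"
  "v1 (x + y) = v1 x + v1 y" "v1 (x - y) = v1 x - v1 y" "v1 (- x) = - v1 x"
  "v1 (x * y) = v1 x * v1 y" "v1 (r *\<^sub>R x) = r * v1 x"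
  "v2 0 = 0" "v2 1 = 1" "v2 hyp_e = 0" "v2 hyp_ed = 1"
  "v2 (x + y) = v2 x + v2 y" "v2 (x - y) = v2 x - v2 y" "v2 (- x) = - v2 x"
  "v2 (x * y) = v2 x * v2 y" "v2 (r *\<^sub>R x) = r * v2 x"
  by (simp_all add: v1_def v2_def hyp_e_def hyp_ed_def hyp_k_def algebra_simps)

lemma v12_eq_iff: "x = y \<longleftrightarrow> v1 x = v1 y \<and> v2 x = v2 y"
  by (auto simp: v1_def v2_def hyperbolic_eq_iff)

lemma idempotent_decomp: "z = v1 z *\<^sub>R hyp_e + v2 z *\<^sub>R hyp_ed"
  by (simp add: v12_eq_iff)

definition hyp_nonneg :: "hyperbolic set"
  where "hyp_nonneg = {a *\<^sub>R hyp_e + b *\<^sub>R hyp_ed | a b. 0 \<le> a \<and> 0 \<le> b}"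

lemma hyp_nonneg_iff: "z \<in> hyp_nonneg \<longleftrightarrow> 0 \<le> v1 z \<and> 0 \<le> v2 z"
  unfolding hyp_nonneg_def using idempotent_decomp[of z] by auto

instantiation hyperbolic :: order
begin

definition less_eq_hyperbolic :: "hyperbolic \<Rightarrow> hyperbolic \<Rightarrow> bool"
  where "x \<le> y \<longleftrightarrow> y - x \<in> hyp_nonneg"

definition less_hyperbolic :: "hyperbolic \<Rightarrow> hyperbolic \<Rightarrow> bool"
  where "x < y \<longleftrightarrow> y - x \<in> hyp_nonneg \<and> x \<noteq> y"

instance
  by standard
    (auto simp: less_eq_hyperbolic_def less_hyperbolic_def hyp_nonneg_iff v12_eq_iff)

end

definition hyp_zero_divisors :: "hyperbolic set"
  where "hyp_zero_divisors = {z. z \<noteq> 0 \<and> (\<exists>w. w \<noteq> 0 \<and> z * w = 0)}"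

lemma hyp_zero_divisors_iff:
  "z \<in> hyp_zero_divisors \<longleftrightarrow> (\<exists>r. r \<noteq> 0 \<and> (z = r *\<^sub>R hyp_e \<or> z = r *\<^sub>R hyp_ed))"
proof
  assume "z \<in> hyp_zero_divisors"
  then have "z \<noteq> 0" "v1 z = 0 \<or> v2 z = 0"
    by (auto simp: hyp_zero_divisors_def v12_eq_iff)
  then show "\<exists>r. r \<noteq> 0 \<and> (z = r *\<^sub>R hyp_e \<or> z = r *\<^sub>R hyp_ed)"
    by (auto simp: v12_eq_iff)
next
  assume "\<exists>r. r \<noteq> 0 \<and> (z = r *\<^sub>R hyp_e \<or> z = r *\<^sub>R hyp_ed)"
  then consider r where "r \<noteq> 0" "z = r *\<^sub>R hyp_e" | r where "r \<noteq> 0" "z = r *\<^sub>R hyp_ed"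
    by blast
  then show "z \<in> hyp_zero_divisors"
  proof cases
    case 1
    then have "z \<noteq> 0 \<and> hyp_ed \<noteq> 0 \<and> z * hyp_ed = 0" by (simp add: v12_eq_iff)
    then show ?thesis unfolding hyp_zero_divisors_def by blast
  next
    case 2
    then have "z \<noteq> 0 \<and> hyp_e \<noteq> 0 \<and> z * hyp_e = 0" by (simp add: v12_eq_iff)
    then show ?thesis unfolding hyp_zero_divisors_def by blast
  qed
qed

text \<open>
  \<open>inverse (a + b k) = (a - b k) / (a\<^sup>2 - b\<^sup>2)\<close>. This is the ring inverse when \<open>z\<close> is neither
  \<open>0\<close> nor a zero divisor; for all other \<open>z\<close> it is \<open>0\<close> by convention.
\<close>

instantiation hyperbolic :: inverse
begin

definition inverse_hyperbolic :: "hyperbolic \<Rightarrow> hyperbolic"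
  where "inverse z = (1 / ((hre z)\<^sup>2 - (him z)\<^sup>2)) *\<^sub>R Hyperbolic (hre z) (- him z)"

definition divide_hyperbolic :: "hyperbolic \<Rightarrow> hyperbolic \<Rightarrow> hyperbolic"
  where "x div y = x * inverse (y :: hyperbolic)"

instance ..

end

lemma hyp_right_inverse:
  assumes "z \<noteq> 0" "z \<notin> hyp_zero_divisors"
  shows "z * inverse z = 1"
proof -
  have "v1 z \<noteq> 0" "v2 z \<noteq> 0"
    using assms by (auto simp: hyp_zero_divisors_iff v12_eq_iff)
  then have "(hre z)\<^sup>2 - (him z)\<^sup>2 \<noteq> 0"
    by (auto simp: v1_def v2_def power2_eq_iff)
  then show ?thesis
    by (simp add: hyperbolic_eq_iff inverse_hyperbolic_def divide_simps)
      (simp add: power2_eq_square)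
qed

text \<open>The usual topology of the plane in the coordinates \<open>(v1, v2)\<close>.\<close>

instantiation hyperbolic :: topological_space
begin

definition open_hyperbolic :: "hyperbolic set \<Rightarrow> bool"
  where "open U \<longleftrightarrow> open ((\<lambda>z. (v1 z, v2 z)) ` U)"

instance
proof
  have inj: "inj (\<lambda>z. (v1 z, v2 z))"
    by (auto simp: inj_def v12_eq_iff)
  have "(\<lambda>z. (v1 z, v2 z)) ` UNIV = UNIV"
  proof (intro equalityI subset_UNIV subsetI)
    fix p :: "real \<times> real"
    have "p = (\<lambda>z. (v1 z, v2 z)) (fst p *\<^sub>R hyp_e + snd p *\<^sub>R hyp_ed)" by simp
    then show "p \<in> range (\<lambda>z. (v1 z, v2 z))" by blast
  qed
  then show "open (UNIV :: hyperbolic set)"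
    by (simp add: open_hyperbolic_def)
  show "open (S \<inter> T)" if "open S" "open T" for S T :: "hyperbolic set"
    using that by (auto simp: open_hyperbolic_def image_Int[OF inj])
  show "open (\<Union>K)" if "\<forall>S\<in>K. open S" for K :: "hyperbolic set set"
    using that by (auto simp: open_hyperbolic_def image_Union)
qed

end

lemma tendsto_hyperbolic_iff:
  "(f \<longlongrightarrow> l) F \<longleftrightarrow> ((\<lambda>x. v1 (f x)) \<longlongrightarrow> v1 l) F \<and> ((\<lambda>x. v2 (f x)) \<longlongrightarrow> v2 l) F"
proof
  let ?c = "\<lambda>z. (v1 z, v2 z)"
  let ?d = "\<lambda>p. fst p *\<^sub>R hyp_e + snd p *\<^sub>R hyp_ed"
  have cd: "?c (?d p) = p" and dc: "?d (?c z) = z" for p z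
    by (simp_all add: v12_eq_iff)
  {
    assume l: "(f \<longlongrightarrow> l) F"
    have "((\<lambda>x. ?c (f x)) \<longlongrightarrow> ?c l) F"
    proof (rule topological_tendstoI)
      fix S assume S: "open S" "?c l \<in> S"
      have "?c ` (?c -` S) = S" using cd by (metis surj_def surj_image_vimage_eq)
      with S have "open (?c -` S)" by (simp add: open_hyperbolic_def)
      from topological_tendstoD[OF l this] S(2)
      show "eventually (\<lambda>x. ?c (f x) \<in> S) F" by simp
    qed
    from tendsto_fst[OF this] tendsto_snd[OF this]
    show "((\<lambda>x. v1 (f x)) \<longlongrightarrow> v1 l) F \<and> ((\<lambda>x. v2 (f x)) \<longlongrightarrow> v2 l) F" by simp
  }
  assume "((\<lambda>x. v1 (f x)) \<longlongrightarrow> v1 l) F \<and> ((\<lambda>x. v2 (f x)) \<longlongrightarrow> v2 l) F"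
  then have l: "((\<lambda>x. ?c (f x)) \<longlongrightarrow> ?c l) F" by (auto intro: tendsto_Pair)
  show "(f \<longlongrightarrow> l) F"
  proof (rule topological_tendstoI)
    fix S assume S: "open S" "l \<in> S"
    have "eventually (\<lambda>x. ?c (f x) \<in> ?c ` S) F"
      using S by (intro topological_tendstoD[OF l]) (auto simp: open_hyperbolic_def)
    then show "eventually (\<lambda>x. f x \<in> S) F"
      by eventually_elim (auto simp: v12_eq_iff dest!: v12_eq_iff[THEN iffD2, OF conjI])
  qed
qed

lemma v12_sum: "v1 (sum f A) = (\<Sum>x\<in>A. v1 (f x))" "v2 (sum f A) = (\<Sum>x\<in>A. v2 (f x))"
  by (induction A rule: infinite_finite_induct; simp)+

lemma sums_hyperbolic_iff:
  "f sums s \<longleftrightarrow> (\<lambda>n. v1 (f n)) sums v1 s \<and> (\<lambda>n. v2 (f n)) sums v2 s"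
  by (simp add: sums_def tendsto_hyperbolic_iff v12_sum)

locale hyp_prob_space = sigma_algebra \<Omega> \<Sigma>
  for \<Omega> :: "'a set" and \<Sigma> :: "'a set set" +
  fixes P :: "'a set \<Rightarrow> hyperbolic"
  assumes P_nonneg: "A \<in> \<Sigma> \<Longrightarrow> 0 \<le> P A"
    and P_space: "P \<Omega> \<in> {1, hyp_e, hyp_ed}"
    and P_countably_additive:
      "range F \<subseteq> \<Sigma> \<Longrightarrow> disjoint_family F \<Longrightarrow>
        (\<lambda>n. P (F n)) sums P (\<Union>n. F n)"

text \<open>
  The real component measures \<open>P1\<close>, \<open>P2\<close>. Since \<open>measure_of\<close> falls back to the zero measure on
  set functions that are not measures, the lemma \<open>emeasure_comp_measures\<close> below is needed to
  see that in a hyperbolic probability space these are the coordinates of \<open>P\<close>.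
\<close>

definition comp_measure1 :: "'a set \<Rightarrow> 'a set set \<Rightarrow> ('a set \<Rightarrow> hyperbolic) \<Rightarrow> 'a measure"
  where "comp_measure1 \<Omega> \<Sigma> P = measure_of \<Omega> \<Sigma> (\<lambda>A. ennreal (v1 (P A)))"

definition comp_measure2 :: "'a set \<Rightarrow> 'a set set \<Rightarrow> ('a set \<Rightarrow> hyperbolic) \<Rightarrow> 'a measure"
  where "comp_measure2 \<Omega> \<Sigma> P = measure_of \<Omega> \<Sigma> (\<lambda>A. ennreal (v2 (P A)))"

definition hyp_random_variable :: "'a set \<Rightarrow> 'a set set \<Rightarrow> ('a \<Rightarrow> hyperbolic) \<Rightarrow> bool"
  where "hyp_random_variable \<Omega> \<Sigma> X \<longleftrightarrow> (\<forall>U. open U \<longrightarrow> X -` U \<inter> \<Omega> \<in> \<Sigma>)"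

definition hyp_integrable ::
    "'a set \<Rightarrow> 'a set set \<Rightarrow> ('a set \<Rightarrow> hyperbolic) \<Rightarrow> ('a \<Rightarrow> hyperbolic) \<Rightarrow> bool"
  where "hyp_integrable \<Omega> \<Sigma> P X \<longleftrightarrow>
    integrable (comp_measure1 \<Omega> \<Sigma> P) (\<lambda>x. v1 (X x)) \<and>
    integrable (comp_measure2 \<Omega> \<Sigma> P) (\<lambda>x. v2 (X x))"

definition hyp_integral ::
    "'a set \<Rightarrow> 'a set set \<Rightarrow> ('a set \<Rightarrow> hyperbolic) \<Rightarrow> 'a set \<Rightarrow> ('a \<Rightarrow> hyperbolic) \<Rightarrow> hyperbolic"
  where "hyp_integral \<Omega> \<Sigma> P B X =
    (LINT x:B|comp_measure1 \<Omega> \<Sigma> P. v1 (X x)) *\<^sub>R hyp_e +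
    (LINT x:B|comp_measure2 \<Omega> \<Sigma> P. v2 (X x)) *\<^sub>R hyp_ed"

definition hyp_expectation ::
    "'a set \<Rightarrow> 'a set set \<Rightarrow> ('a set \<Rightarrow> hyperbolic) \<Rightarrow> ('a \<Rightarrow> hyperbolic) \<Rightarrow> hyperbolic"
  where "hyp_expectation \<Omega> \<Sigma> P X = hyp_integral \<Omega> \<Sigma> P \<Omega> X"

text \<open>
  In the third and fourth cases \<open>v1 (P B)\<close> and \<open>v2 (P B)\<close> are the scalars \<open>\<lambda>\<^sub>1\<close>, \<open>\<lambda>\<^sub>2\<close> with
  \<open>P B = \<lambda>\<^sub>1 e\<close> and \<open>P B = \<lambda>\<^sub>2 e\<^sup>\<dagger>\<close>. For \<open>B\<close> in \<open>\<Sigma>\<close> one of the four cases always holds, so the value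
  \<open>undefined\<close> is never taken there.
\<close>

definition hyp_cond_expectation ::
    "'a set \<Rightarrow> 'a set set \<Rightarrow> ('a set \<Rightarrow> hyperbolic) \<Rightarrow> 'a set \<Rightarrow> ('a \<Rightarrow> hyperbolic) \<Rightarrow> hyperbolic"
  where "hyp_cond_expectation \<Omega> \<Sigma> P B X =
    (if 0 < P B \<and> P B \<notin> hyp_zero_divisors then
       (1 / P B) * hyp_integral \<Omega> \<Sigma> P B X
     else if P B = 0 then
       hyp_expectation \<Omega> \<Sigma> P X
     else if \<exists>l>0. P B = l *\<^sub>R hyp_e then
       (1 / v1 (P B)) *\<^sub>R hyp_integral \<Omega> \<Sigma> P B X * hyp_e + hyp_expectation \<Omega> \<Sigma> P X * hyp_ed
     else if \<exists>l>0. P B = l *\<^sub>R hyp_ed then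
       hyp_expectation \<Omega> \<Sigma> P X * hyp_e + (1 / v2 (P B)) *\<^sub>R hyp_integral \<Omega> \<Sigma> P B X * hyp_ed
     else undefined)"

context hyp_prob_space
begin

lemma v12_nonneg: "A \<in> \<Sigma> \<Longrightarrow> 0 \<le> v1 (P A)" "A \<in> \<Sigma> \<Longrightarrow> 0 \<le> v2 (P A)"
  using P_nonneg[of A] by (simp_all add: less_eq_hyperbolic_def hyp_nonneg_iff)

lemma P_empty: "P {} = 0"
proof -
  have "(\<lambda>n::nat. P {}) sums P (\<Union>n::nat. {})"
    by (rule P_countably_additive) (auto simp: disjoint_family_on_def)
  then have "(\<lambda>n::nat. v1 (P {})) sums v1 (P {})" "(\<lambda>n::nat. v2 (P {})) sums v2 (P {})"
    by (simp_all add: sums_hyperbolic_iff)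
  then have "summable (\<lambda>n::nat. v1 (P {}))" "summable (\<lambda>n::nat. v2 (P {}))"
    by (auto simp: summable_def)
  then have "v1 (P {}) = 0" "v2 (P {}) = 0"
    by (auto dest!: summable_LIMSEQ_zero simp: LIMSEQ_const_iff)
  then show ?thesis by (simp add: v12_eq_iff)
qed

lemma measure_space_comps:
  "measure_space \<Omega> \<Sigma> (\<lambda>A. ennreal (v1 (P A)))"
  "measure_space \<Omega> \<Sigma> (\<lambda>A. ennreal (v2 (P A)))"
proof -
  have "(\<Sum>n. ennreal (v1 (P (A n)))) = ennreal (v1 (P (\<Union>n. A n)))"
       "(\<Sum>n. ennreal (v2 (P (A n)))) = ennreal (v2 (P (\<Union>n. A n)))"
    if A: "range A \<subseteq> \<Sigma>" "disjoint_family A" for A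
    using P_countably_additive[OF A] v12_nonneg A(1)
    by (auto simp: sums_hyperbolic_iff range_subsetD intro!: suminf_ennreal_eq)
  then show "measure_space \<Omega> \<Sigma> (\<lambda>A. ennreal (v1 (P A)))"
       "measure_space \<Omega> \<Sigma> (\<lambda>A. ennreal (v2 (P A)))"
    by (auto simp: measure_space_def positive_def countably_additive_def P_empty
        sigma_algebra_axioms)
qed

lemma comp_measures_space_sets [simp]:
  "space (comp_measure1 \<Omega> \<Sigma> P) = \<Omega>" "sets (comp_measure1 \<Omega> \<Sigma> P) = \<Sigma>"
  "space (comp_measure2 \<Omega> \<Sigma> P) = \<Omega>" "sets (comp_measure2 \<Omega> \<Sigma> P) = \<Sigma>"
  by (simp_all add: comp_measure1_def comp_measure2_def)

lemma emeasure_comp_measures: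
  assumes "A \<in> \<Sigma>"
  shows "emeasure (comp_measure1 \<Omega> \<Sigma> P) A = ennreal (v1 (P A))"
    and "emeasure (comp_measure2 \<Omega> \<Sigma> P) A = ennreal (v2 (P A))"
  using assms measure_space_comps unfolding comp_measure1_def comp_measure2_def
  by (auto simp: measure_space_def intro!: emeasure_measure_of_sigma)

lemma cond_expectation_exhaustive:
  assumes "B \<in> \<Sigma>"
  shows "0 < P B \<and> P B \<notin> hyp_zero_divisors \<or> P B = 0 \<or>
    (\<exists>l>0. P B = l *\<^sub>R hyp_e) \<or> (\<exists>l>0. P B = l *\<^sub>R hyp_ed)"
  using v12_nonneg[OF assms]
  by (auto simp: less_hyperbolic_def hyp_nonneg_iff hyp_zero_divisors_iff v12_eq_iff less_le)

end

end

theory Submission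
  imports Defs
begin

text \<open>
  Multiplying by \<open>P B\<close> undoes the normalisation in every case of the definition:
  \<open>P B * E\<^sub>B(X) = \<integral>\<^sub>B X dP\<close>. Indeed, whenever a coordinate of \<open>P B\<close> vanishes, \<open>B\<close> is null for the
  corresponding real measure, so that coordinate of the integral vanishes as well. The claim is
  then additivity of the integral over disjoint sets.
\<close>

lemma set_lebesgue_integral_null_set:
  fixes f :: "'a \<Rightarrow> 'b::{banach, second_countable_topology}"
  assumes "N \<in> null_sets M"
  shows "(LINT x:N|M. f x) = 0"
  unfolding set_lebesgue_integral_def
proof (rule integral_eq_zero_AE)
  show "AE x in M. indicator N x *\<^sub>R f x = 0"
    using AE_not_in[OF assms] by eventually_elim simp
qed

lemma v12_hyp_integral [simp]:
  "v1 (hyp_integral \<Omega> \<Sigma> P B X) = (LINT x:B|comp_measure1 \<Omega> \<Sigma> P. v1 (X x))"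
  "v2 (hyp_integral \<Omega> \<Sigma> P B X) = (LINT x:B|comp_measure2 \<Omega> \<Sigma> P. v2 (X x))"
  by (simp_all add: hyp_integral_def)

context hyp_prob_space
begin

lemma hyp_integral_Un:
  assumes "hyp_integrable \<Omega> \<Sigma> P X" "A \<in> \<Sigma>" "B \<in> \<Sigma>" "A \<inter> B = {}"
  shows "hyp_integral \<Omega> \<Sigma> P (A \<union> B) X = hyp_integral \<Omega> \<Sigma> P A X + hyp_integral \<Omega> \<Sigma> P B X"
proof -
  have "set_integrable (comp_measure1 \<Omega> \<Sigma> P) C (\<lambda>x. v1 (X x))"
       "set_integrable (comp_measure2 \<Omega> \<Sigma> P) C (\<lambda>x. v2 (X x))" if "C \<in> \<Sigma>" for C
    using assms(1) that unfolding hyp_integrable_def set_integrable_def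
    \<comment> \<open>\<open>integrable_mult_indicator\<close> is stated with
      \<open>*\<^sub>R\<close>, which \<open>real_scaleR_def\<close> would rewrite away.\<close>
    by (simp_all add: integrable_mult_indicator del: real_scaleR_def)
  with assms show ?thesis
    by (simp add: v12_eq_iff set_integral_Un)
qed

text \<open>Covers the coordinates in which the conditional expectation falls back to the global
  one.\<close>

lemma v12_hyp_integral_eq_0:
  assumes "B \<in> \<Sigma>"
  shows "v1 (P B) = 0 \<Longrightarrow> v1 (hyp_integral \<Omega> \<Sigma> P B X) = 0"
    and "v2 (P B) = 0 \<Longrightarrow> v2 (hyp_integral \<Omega> \<Sigma> P B X) = 0"
  using assms
  by (auto simp: emeasure_comp_measures intro!: set_lebesgue_integral_null_set null_setsI)

lemma P_mult_cond_expectation: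
  assumes "B \<in> \<Sigma>"
  shows "P B * hyp_cond_expectation \<Omega> \<Sigma> P B X = hyp_integral \<Omega> \<Sigma> P B X"
proof -
  consider (unit) "0 < P B" "P B \<notin> hyp_zero_divisors"
    | (zero) "P B = 0"
    | (e) l where "l > 0" "P B = l *\<^sub>R hyp_e"
    | (ed) l where "l > 0" "P B = l *\<^sub>R hyp_ed"
    using cond_expectation_exhaustive[OF assms] by blast
  then show ?thesis
  proof cases
    case unit
    \<comment> \<open>Division is total, so cancelling uses that \<open>P B\<close> is neither zero
      nor a zero divisor.\<close>
    have "P B * (1 / P B) = 1"
      using unit by (simp add: divide_hyperbolic_def hyp_right_inverse)
    with unit show ?thesis
      by (simp add: hyp_cond_expectation_def flip: mult.assoc)
  next
    case zero
    then show ?thesis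
      using v12_hyp_integral_eq_0[OF assms, of X] by (simp add: v12_eq_iff)
  next
    case e
    \<comment> \<open>These facts rule out the first two branches of the definition.\<close>
    then have "P B \<in> hyp_zero_divisors" "P B \<noteq> 0"
      by (auto simp: hyp_zero_divisors_iff v12_eq_iff)
    with e have "hyp_cond_expectation \<Omega> \<Sigma> P B X =
        (1 / l) *\<^sub>R hyp_integral \<Omega> \<Sigma> P B X * hyp_e + hyp_expectation \<Omega> \<Sigma> P X * hyp_ed"
      by (auto simp: hyp_cond_expectation_def)
    \<comment> \<open>In the first coordinate \<open>l\<close> cancels; in the second both sides are
      0.\<close>
    then show ?thesis
      using e v12_hyp_integral_eq_0(2)[OF assms, of X] by (simp add: v12_eq_iff)
  next
    case ed
    \<comment> \<open>The \<open>hyp_e\<close> branch is tested earlier, so it must be excluded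
      too.\<close>
    then have "P B \<in> hyp_zero_divisors" "P B \<noteq> 0" "\<nexists>r. r > 0 \<and> P B = r *\<^sub>R hyp_e"
      by (auto simp: hyp_zero_divisors_iff v12_eq_iff)
    with ed have "hyp_cond_expectation \<Omega> \<Sigma> P B X =
        hyp_expectation \<Omega> \<Sigma> P X * hyp_e + (1 / l) *\<^sub>R hyp_integral \<Omega> \<Sigma> P B X * hyp_ed"
      by (auto simp: hyp_cond_expectation_def)
    then show ?thesis
      using ed v12_hyp_integral_eq_0(1)[OF assms, of X] by (simp add: v12_eq_iff)
  qed
qed

end

theorem theorem8p2:
  fixes \<Omega> :: "'a set" and \<Sigma> :: "'a set set" and P :: "'a set \<Rightarrow> hyperbolic"
    and X :: "'a \<Rightarrow> hyperbolic" and A B :: "'a set"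
  assumes "hyp_prob_space \<Omega> \<Sigma> P"
    and "hyp_random_variable \<Omega> \<Sigma> X"
    and "hyp_integrable \<Omega> \<Sigma> P X"
    and "A \<in> \<Sigma>" and "B \<in> \<Sigma>"
    and "A \<inter> B = {}"
  shows "P (A \<union> B) * hyp_cond_expectation \<Omega> \<Sigma> P (A \<union> B) X =
         P A * hyp_cond_expectation \<Omega> \<Sigma> P A X + P B * hyp_cond_expectation \<Omega> \<Sigma> P B X"
proof -
  interpret hyp_prob_space \<Omega> \<Sigma> P by fact
  show ?thesis
    \<comment> \<open>\<open>Un\<close> gives \<open>A \<union> B \<in> \<Sigma>\<close>, so all
      three products become integrals.\<close>
    using assms(3-6) by (simp add: Un P_mult_cond_expectation hyp_integral_Un)
qed

end
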